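(* Let $F$ be a field with $\operatorname{char} F = 0$. Let $n\ge 1$ and $t\ge 1$ be integers and let $q_1,\dots,q_n \in \{{\tt A},{\tt S}\}$. Then the sequence $q_1 q_2 \cdots q_{n}\underbrace{{\tt N}\cdots{\tt N}}_{t}$ (consisting of $q_1,\dots,q_n$ followed by $t$ copies of ${\tt N}$) is the qpr-sequence of some symmetric matrix in $F^{(n+t)\times(n+t)}$.
   Context: For an $m\times m$ matrix $B$ and $\alpha,\beta\subseteq\{1,\dots,m\}$, $B[\alpha,\beta]$ denotes the submatrix with rows indexed by $\alpha$ and columns indexed by $\beta$. $B[\alpha,\beta]$ is a quasi-principal submatrix if $|\alpha|=|\beta|$ and $|\alpha|-1\le|\alpha\cap\beta|\le|\alpha|$; its determinant is then a quasi-principal minor of order $|\alpha|$. The quasi principal rank characteristic sequence (qpr-sequence) of a symmetric $B\in F^{m\times m}$ is $\operatorname{qpr}(B)=q_1q_2\cdots q_m$, where $q_k={\tt A}$ if all quasi-principal minors of order $k$ are nonzero, $q_k={\tt S}$ if some but not all are nonzero, and $q_k={\tt N}$ if all are zero. *)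

theory Defs
  imports "Jordan_Normal_Form.Determinant" "Jordan_Normal_Form.DL_Submatrix"
begin

(* Rows and columns of a matrix are indexed from 0, so index sets are subsets of {0..<m}. *)

definition quasi_principal :: "nat \<Rightarrow> nat set \<Rightarrow> nat set \<Rightarrow> bool" where
  "quasi_principal m \<alpha> \<beta> \<longleftrightarrow>
     \<alpha> \<subseteq> {0..<m} \<and> \<beta> \<subseteq> {0..<m} \<and> card \<alpha> = card \<beta> \<and>
     card \<alpha> - 1 \<le> card (\<alpha> \<inter> \<beta>) \<and> card (\<alpha> \<inter> \<beta>) \<le> card \<alpha>"

definition qp_minors :: "'a::field mat \<Rightarrow> nat \<Rightarrow> 'a set" where
  "qp_minors B k =
     {det (submatrix B \<alpha> \<beta>) | \<alpha> \<beta>. quasi_principal (dim_row B) \<alpha> \<beta> \<and> card \<alpha> = k}"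

datatype qpr_letter = A | S | N

(* For 1 \<le> k \<le> dim_row B the set of minors is nonempty, so the cases A and N exclude each other. *)
definition qpr_entry :: "'a::field mat \<Rightarrow> nat \<Rightarrow> qpr_letter" where
  "qpr_entry B k =
     (if \<forall>d \<in> qp_minors B k. d \<noteq> 0 then A
      else if \<exists>d \<in> qp_minors B k. d \<noteq> 0 then S
      else N)"

(* q_k is stored at position k - 1 of the list. *)
definition qpr :: "'a::field mat \<Rightarrow> qpr_letter list" where
  "qpr B = map (qpr_entry B) [1..<Suc (dim_row B)]"

end

theory Submission
  imports Defs "Jordan_Normal_Form.Char_Poly"
begin

text \<open>Put \<open>m = n + t\<close> and \<open>B = (\<Sum>i<n. d i \<cdot> M\<^sub>i\<^sup>T M\<^sub>i)\<close> with row vectors \<open>M\<^sub>i\<close> of length \<open>m\<close>, so that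
  minors of order above \<open>n\<close> vanish. Outside column \<open>n\<close> the array \<open>M\<close> is upper triangular and
  generic; the entry of column \<open>n\<close> in row \<open>k - 1\<close> is 0 if the \<open>k\<close>-th letter is \<open>S\<close> and generic
  otherwise. In the first case row \<open>k - 1\<close> of \<open>M\<close> vanishes on \<open>{0..<k - 1} \<union> {n}\<close>, and triangularity
  makes the minor of \<open>B\<close> on rows \<open>{0..<k}\<close> and these columns vanish; in the second case all minors
  of \<open>M\<close> on its first \<open>k\<close> rows are nonzero.

  Both \<open>M\<close> and \<open>d\<close> are found by avoiding roots of finitely many polynomials. A new column of \<open>M\<close>
  has entries \<open>y\<^sup>i\<close> in the rows where it may be nonzero; by Laplace expansion, a minor of order \<open>k\<close>
  through it is a polynomial in \<open>y\<close> whose coefficient at \<open>k - 1\<close> is, up to sign, a minor without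
  the new column. After \<open>k\<close> summands a minor of \<open>B\<close> of order \<open>k\<close> is the product of the weights
  and two minors of \<open>M\<close>; it is a polynomial in each subsequent weight.\<close>

section \<open>Minors of weighted Gram matrices\<close>

lemma submatrix_mat:
  assumes "\<alpha> \<subseteq> {0..<m}" and "\<beta> \<subseteq> {0..<n}"
  shows "submatrix (mat m n f) \<alpha> \<beta> =
    mat (card \<alpha>) (card \<beta>) (\<lambda>(a, b). f (pick \<alpha> a, pick \<beta> b))"
proof -
  have eq: "{i. i < m \<and> i \<in> \<alpha>} = \<alpha>" "{j. j < n \<and> j \<in> \<beta>} = \<beta>" using assms by auto
  have "pick \<alpha> a < m" if "a < card \<alpha>" for a using that by (intro pick_le) (simp add: eq)
  moreover have "pick \<beta> b < n" if "b < card \<beta>" for b using that by (intro pick_le) (simp add: eq)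
  ultimately show ?thesis by (intro eq_matI) (auto simp: submatrix_def eq)
qed

lemma det_mat_diag: "det (mat_diag n d) = (\<Prod>i<n. d i)"
proof -
  have "det (mat_diag n d) = prod_list (diag_mat (mat_diag n d))"
    by (rule det_upper_triangular[of _ n]) (auto simp: mat_diag_def)
  also have "\<dots> = (\<Prod>i<n. d i)"
    by (simp add: mat_diag_def prod_list_diag_prod atLeast0LessThan)
  finally show ?thesis .
qed

lemma det_mat_sum_products:
  fixes d :: "nat \<Rightarrow> 'a::comm_ring_1"
  shows "det (mat k k (\<lambda>(a, b). \<Sum>i<k. d i * f i a * g i b)) =
    (\<Prod>i<k. d i) * det (mat k k (\<lambda>(i, a). f i a)) * det (mat k k (\<lambda>(i, b). g i b))"
proof -
  let ?F = "mat k k (\<lambda>(i, a). f i a)" and ?G = "mat k k (\<lambda>(i, b). g i b)"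
  have "mat k k (\<lambda>(a, b). \<Sum>i<k. d i * f i a * g i b) = ?F\<^sup>T * (mat_diag k d * ?G)"
    by (intro eq_matI)
      (auto simp: mat_diag_mult_left[of _ k k] scalar_prod_def atLeast0LessThan mult_ac
        intro!: sum.cong)
  also have "det \<dots> = det ?F\<^sup>T * (det (mat_diag k d) * det ?G)"
    by (simp add: det_mult[of _ k] mult_carrier_mat[of _ k k])
  also have "det ?F\<^sup>T = det ?F"
    by (rule det_transpose[of _ k]) simp
  finally show ?thesis by (simp add: det_mat_diag mult_ac)
qed

definition top_mat :: "(nat \<Rightarrow> nat \<Rightarrow> 'a) \<Rightarrow> nat set \<Rightarrow> 'a mat" where
  "top_mat M \<alpha> = mat (card \<alpha>) (card \<alpha>) (\<lambda>(i, a). M i (pick \<alpha> a))"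

lemma top_mat_carrier [simp]: "top_mat M \<alpha> \<in> carrier_mat (card \<alpha>) (card \<alpha>)"
  by (simp add: top_mat_def)

lemma top_mat_index [simp]:
  "i < card \<alpha> \<Longrightarrow> a < card \<alpha> \<Longrightarrow> top_mat M \<alpha> $$ (i, a) = M i (pick \<alpha> a)"
  by (simp add: top_mat_def)

definition top_minor :: "(nat \<Rightarrow> nat \<Rightarrow> 'a::comm_ring_1) \<Rightarrow> nat set \<Rightarrow> 'a" where
  "top_minor M \<alpha> = det (top_mat M \<alpha>)"

lemma top_minor_empty [simp]: "top_minor M {} = 1"
  by (simp add: top_minor_def top_mat_def)

lemma top_minor_cong:
  assumes "\<And>i a. i < card \<alpha> \<Longrightarrow> a \<in> \<alpha> \<Longrightarrow> M i a = M' i a"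
  shows "top_minor M \<alpha> = top_minor M' \<alpha>"
  unfolding top_minor_def top_mat_def
  by (intro arg_cong[of _ _ det] eq_matI) (auto simp: assms pick_in_set_le)

lemma top_minor_eq_0_if_row_0:
  assumes "i < card \<alpha>" and "\<And>a. a \<in> \<alpha> \<Longrightarrow> M i a = 0"
  shows "top_minor M \<alpha> = 0"
proof -
  have "top_minor M \<alpha> = (\<Sum>a<card \<alpha>. top_mat M \<alpha> $$ (i, a) * cofactor (top_mat M \<alpha>) i a)"
    unfolding top_minor_def using assms(1) by (intro laplace_expansion_row) auto
  also have "\<dots> = 0" using assms by (simp add: pick_in_set_le)
  finally show ?thesis .
qed

definition gram_mat ::
    "(nat \<Rightarrow> 'a::comm_ring_1) \<Rightarrow> (nat \<Rightarrow> nat \<Rightarrow> 'a) \<Rightarrow> nat \<Rightarrow> nat \<Rightarrow> 'a mat" where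
  "gram_mat d M r m = mat m m (\<lambda>(a, b). \<Sum>i<r. d i * M i a * M i b)"

lemma gram_mat_carrier [simp]: "gram_mat d M r m \<in> carrier_mat m m"
  by (simp add: gram_mat_def)

lemma dim_row_gram_mat [simp]: "dim_row (gram_mat d M r m) = m"
  by (simp add: gram_mat_def)

lemma transpose_gram_mat: "(gram_mat d M r m)\<^sup>T = gram_mat d M r m"
  by (intro eq_matI) (auto simp: gram_mat_def mult_ac)

lemma submatrix_gram_mat:
  assumes "\<alpha> \<subseteq> {0..<m}" and "\<beta> \<subseteq> {0..<m}"
  shows "submatrix (gram_mat d M r m) \<alpha> \<beta> =
    mat (card \<alpha>) (card \<beta>) (\<lambda>(a, b). \<Sum>i<r. d i * M i (pick \<alpha> a) * M i (pick \<beta> b))"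
  unfolding gram_mat_def by (simp add: submatrix_mat[OF assms])

lemma det_submatrix_gram_mat:
  assumes "\<alpha> \<subseteq> {0..<m}" and "\<beta> \<subseteq> {0..<m}" and "card \<alpha> = k" and "card \<beta> = k" and "k \<le> r"
    and vanish: "\<And>i a. k \<le> i \<Longrightarrow> i < r \<Longrightarrow> a \<in> \<alpha> \<Longrightarrow> M i a = 0"
  shows "det (submatrix (gram_mat d M r m) \<alpha> \<beta>) =
    (\<Prod>i<k. d i) * top_minor M \<alpha> * top_minor M \<beta>"
proof -
  have "(\<Sum>i<r. d i * M i a * M i b) = (\<Sum>i<k. d i * M i a * M i b)" if "a \<in> \<alpha>" for a b
    using \<open>k \<le> r\<close> vanish[OF _ _ that] by (intro sum.mono_neutral_right) auto
  then have "submatrix (gram_mat d M r m) \<alpha> \<beta> =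
      mat k k (\<lambda>(a, b). \<Sum>i<k. d i * M i (pick \<alpha> a) * M i (pick \<beta> b))"
    unfolding submatrix_gram_mat[OF assms(1,2)] assms(3,4)
    by (intro eq_matI) (auto simp: pick_in_set_le assms(3))
  then show ?thesis by (simp add: det_mat_sum_products top_minor_def top_mat_def assms(3,4))
qed

lemma det_submatrix_gram_mat_eq_0:
  assumes "\<alpha> \<subseteq> {0..<m}" and "\<beta> \<subseteq> {0..<m}" and "card \<alpha> = k" and "card \<beta> = k" and "r < k"
  shows "det (submatrix (gram_mat d M r m) \<alpha> \<beta>) = 0"
proof -
  define d' where "d' i = (if i < r then d i else 0)" for i
  have "(\<Sum>i<r. d i * M i a * M i b) = (\<Sum>i<k. d' i * M i a * M i b)" for a b
    using \<open>r < k\<close> by (intro sum.mono_neutral_cong_left) (auto simp: d'_def)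
  then have "gram_mat d M r m = gram_mat d' M k m" by (simp add: gram_mat_def)
  moreover have "(\<Prod>i<k. d' i) = 0"
    using \<open>r < k\<close> by (intro prod_zero bexI[of _ r]) (auto simp: d'_def)
  ultimately show ?thesis by (simp add: det_submatrix_gram_mat[OF assms(1-4)])
qed

section \<open>Generic weights\<close>

lemma finite_roots_det_pencil:
  fixes A U :: "'a::idom mat"
  assumes A: "A \<in> carrier_mat k k" and U: "U \<in> carrier_mat k k"
    and nonzero: "det (A + x \<cdot>\<^sub>m U) \<noteq> 0"
  shows "finite {y. det (A + y \<cdot>\<^sub>m U) = 0}"
proof -
  define p where "p = det (mat k k (\<lambda>(a, b). [:A $$ (a, b), U $$ (a, b):]))"
  have p: "poly p y = det (A + y \<cdot>\<^sub>m U)" for y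
    unfolding p_def using A U by (intro poly_det_cong[of _ k]) auto
  then have "p \<noteq> 0" using nonzero by auto
  then show ?thesis using poly_roots_finite[of p] by (simp add: p)
qed

lemma submatrix_gram_mat_Suc:
  assumes "\<alpha> \<subseteq> {0..<m}" and "\<beta> \<subseteq> {0..<m}"
  shows "submatrix (gram_mat (d(r := y)) M (Suc r) m) \<alpha> \<beta> =
    submatrix (gram_mat d M r m) \<alpha> \<beta> +
    y \<cdot>\<^sub>m mat (card \<alpha>) (card \<beta>) (\<lambda>(a, b). M r (pick \<alpha> a) * M r (pick \<beta> b))"
proof -
  have "(\<Sum>i<r. (d(r := y)) i * M i a * M i b) = (\<Sum>i<r. d i * M i a * M i b)" for a b
    by (intro sum.cong) auto
  then show ?thesis
    unfolding submatrix_gram_mat[OF assms] by (intro eq_matI) (auto simp: mult.assoc)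
qed

definition generic_weights ::
    "(nat \<Rightarrow> nat \<Rightarrow> 'a::comm_ring_1) \<Rightarrow> nat \<Rightarrow> nat \<Rightarrow> (nat \<Rightarrow> 'a) \<Rightarrow> bool" where
  "generic_weights M r m d \<longleftrightarrow>
    (\<forall>\<alpha> \<beta>. \<alpha> \<subseteq> {0..<m} \<longrightarrow> \<beta> \<subseteq> {0..<m} \<longrightarrow> card \<alpha> = card \<beta> \<longrightarrow> card \<alpha> \<le> r \<longrightarrow>
      top_minor M \<alpha> \<noteq> 0 \<longrightarrow> top_minor M \<beta> \<noteq> 0 \<longrightarrow>
      det (submatrix (gram_mat d M r m) \<alpha> \<beta>) \<noteq> 0)"

lemma finite_roots_last_weight:
  fixes M :: "nat \<Rightarrow> nat \<Rightarrow> 'a::idom"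
  assumes sub: "\<alpha> \<subseteq> {0..<m}" "\<beta> \<subseteq> {0..<m}" and card: "card \<alpha> = card \<beta>" "card \<alpha> \<le> Suc r"
    and top: "top_minor M \<alpha> \<noteq> 0" "top_minor M \<beta> \<noteq> 0"
    and d: "\<And>i. d i \<noteq> 0" "generic_weights M r m d"
  shows "finite {y. det (submatrix (gram_mat (d(r := y)) M (Suc r) m) \<alpha> \<beta>) = 0}"
proof -
  let ?U = "mat (card \<alpha>) (card \<beta>) (\<lambda>(a, b). M r (pick \<alpha> a) * M r (pick \<beta> b))"
  have "\<exists>x. det (submatrix (gram_mat (d(r := x)) M (Suc r) m) \<alpha> \<beta>) \<noteq> 0"
  proof (cases "card \<alpha> = Suc r")
    case True
    then have "det (submatrix (gram_mat (d(r := 1)) M (Suc r) m) \<alpha> \<beta>) \<noteq> 0"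
      using card top d(1) by (subst det_submatrix_gram_mat[OF sub True]) auto
    then show ?thesis ..
  next
    case False
    then have "det (submatrix (gram_mat d M r m) \<alpha> \<beta>) \<noteq> 0"
      using sub card top d(2) by (simp add: generic_weights_def)
    moreover have "submatrix (gram_mat (d(r := 0)) M (Suc r) m) \<alpha> \<beta> = submatrix (gram_mat d M r m) \<alpha> \<beta>"
      using sub by (intro arg_cong[of _ _ "\<lambda>B. submatrix B \<alpha> \<beta>"])
        (auto simp: gram_mat_def intro!: eq_matI sum.cong)
    ultimately show ?thesis by metis
  qed
  then obtain x where "det (submatrix (gram_mat d M r m) \<alpha> \<beta> + x \<cdot>\<^sub>m ?U) \<noteq> 0"
    unfolding submatrix_gram_mat_Suc[OF sub] ..
  then show ?thesis
    unfolding submatrix_gram_mat_Suc[OF sub] using card(1)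
    by (intro finite_roots_det_pencil[of _ "card \<alpha>"]) (auto simp: submatrix_gram_mat[OF sub])
qed

lemma ex_generic_weights:
  fixes M :: "nat \<Rightarrow> nat \<Rightarrow> 'a::idom"
  assumes "infinite (UNIV :: 'a set)"
  shows "\<exists>d. (\<forall>i. d i \<noteq> 0) \<and> generic_weights M r m d"
proof (induction r)
  case 0
  have "generic_weights M 0 m (\<lambda>_. 1)"
    by (auto simp: generic_weights_def submatrix_gram_mat)
  then show ?case by (intro exI[of _ "\<lambda>_. 1"]) simp
next
  case (Suc r)
  then obtain d where d: "\<And>i. d i \<noteq> 0" "generic_weights M r m d" by blast
  let ?I = "{(\<alpha>, \<beta>). \<alpha> \<subseteq> {0..<m} \<and> \<beta> \<subseteq> {0..<m} \<and> card \<alpha> = card \<beta> \<and> card \<alpha> \<le> Suc r \<and>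
    top_minor M \<alpha> \<noteq> 0 \<and> top_minor M \<beta> \<noteq> 0}"
  let ?bad = "\<lambda>(\<alpha>, \<beta>). {y. det (submatrix (gram_mat (d(r := y)) M (Suc r) m) \<alpha> \<beta>) = 0}"
  have "finite ?I" by (rule finite_subset[of _ "Pow {0..<m} \<times> Pow {0..<m}"]) auto
  moreover have "finite (?bad i)" if "i \<in> ?I" for i
    using that finite_roots_last_weight[OF _ _ _ _ _ _ d] by auto
  ultimately have "finite (insert 0 (\<Union>i\<in>?I. ?bad i))" by blast
  from ex_new_if_finite[OF assms this] obtain y where y: "y \<notin> insert 0 (\<Union>i\<in>?I. ?bad i)" ..
  have "generic_weights M (Suc r) m (d(r := y))"
    unfolding generic_weights_def using y by blast
  moreover have "(d(r := y)) i \<noteq> 0" for i using d(1) y by auto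
  ultimately show ?case by blast
qed

section \<open>Arrays with nonzero minors\<close>

definition set_column :: "(nat \<Rightarrow> nat \<Rightarrow> 'a) \<Rightarrow> nat \<Rightarrow> (nat \<Rightarrow> 'a) \<Rightarrow> nat \<Rightarrow> nat \<Rightarrow> 'a" where
  "set_column M j v = (\<lambda>i. (M i)(j := v i))"

lemma top_minor_set_column_outside:
  assumes "j \<notin> \<alpha>"
  shows "top_minor (set_column M j v) \<alpha> = top_minor M \<alpha>"
  using assms by (intro top_minor_cong) (auto simp: set_column_def)

lemma pick_insert:
  assumes "finite \<gamma>" and "j \<notin> \<gamma>" and "b < card \<gamma>"
  shows "pick (insert j \<gamma>) (insert_index (card {a\<in>\<gamma>. a < j}) b) = pick \<gamma> b"
proof -
  let ?i = "pick \<gamma> b"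
  have i: "?i \<in> \<gamma>" "card {a\<in>\<gamma>. a < ?i} = b"
    using pick_in_set_le[OF assms(3)] card_pick_le[OF assms(3)] by auto
  have "card {a \<in> insert j \<gamma>. a < ?i} = insert_index (card {a\<in>\<gamma>. a < j}) b"
  proof (cases "?i < j")
    case True
    then have "{a\<in>\<gamma>. a < ?i} \<subset> {a\<in>\<gamma>. a < j}" using i(1) by auto
    from psubset_card_mono[OF _ this] have "b < card {a\<in>\<gamma>. a < j}" using assms(1) i(2) by simp
    moreover have "{a \<in> insert j \<gamma>. a < ?i} = {a\<in>\<gamma>. a < ?i}" using True by auto
    ultimately show ?thesis using i(2) by simp
  next
    case False
    then have less: "j < ?i" using assms(2) i(1) by (metis linorder_neqE_nat)
    then have "{a\<in>\<gamma>. a < j} \<subseteq> {a\<in>\<gamma>. a < ?i}" by auto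
    from card_mono[OF _ this] have "card {a\<in>\<gamma>. a < j} \<le> b" using assms(1) i(2) by simp
    moreover have "{a \<in> insert j \<gamma>. a < ?i} = insert j {a\<in>\<gamma>. a < ?i}" using less by auto
    ultimately show ?thesis using assms(1,2) i(2) by simp
  qed
  then show ?thesis using pick_card_in_set[of ?i "insert j \<gamma>"] i(1) by simp
qed

lemma mat_delete_top_mat_insert:
  assumes "finite \<gamma>" and "j \<notin> \<gamma>" and "i \<le> card \<gamma>"
  shows "mat_delete (top_mat (set_column M j v) (insert j \<gamma>)) i (card {a\<in>\<gamma>. a < j}) =
    top_mat (\<lambda>i'. M (insert_index i i')) \<gamma>"
proof (intro eq_matI)
  let ?s = "card {a\<in>\<gamma>. a < j}" and ?X = "top_mat (set_column M j v) (insert j \<gamma>)"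
  have carrier: "?X \<in> carrier_mat (Suc (card \<gamma>)) (Suc (card \<gamma>))"
    using top_mat_carrier[of _ "insert j \<gamma>"] assms(1,2) by simp
  have "?s \<le> card \<gamma>" using assms(1) by (intro card_mono) auto
  fix i' b
  assume "i' < dim_row (top_mat (\<lambda>i'. M (insert_index i i')) \<gamma>)"
    and "b < dim_col (top_mat (\<lambda>i'. M (insert_index i i')) \<gamma>)"
  then have ib: "i' < card \<gamma>" "b < card \<gamma>" by (auto simp: top_mat_def)
  then have "insert_index i i' < card (insert j \<gamma>)" "insert_index ?s b < card (insert j \<gamma>)"
    using assms(1,2) by (auto simp: insert_index_def)
  moreover have "pick \<gamma> b \<noteq> j" using pick_in_set_le[OF ib(2)] assms(2) by auto
  ultimately have "?X $$ (insert_index i i', insert_index ?s b) = M (insert_index i i') (pick \<gamma> b)"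
    using pick_insert[OF assms(1,2) ib(2)] by (simp add: set_column_def)
  then show "mat_delete ?X i ?s $$ (i', b) = top_mat (\<lambda>i'. M (insert_index i i')) \<gamma> $$ (i', b)"
    using mat_delete_index[OF carrier _ _ ib] assms(3) \<open>?s \<le> card \<gamma>\<close> ib by simp
qed (use assms in \<open>auto simp: top_mat_def\<close>)

lemma top_minor_set_column_insert:
  assumes "finite \<gamma>" and "j \<notin> \<gamma>"
  shows "top_minor (set_column M j v) (insert j \<gamma>) = (\<Sum>i\<le>card \<gamma>.
    v i * ((- 1) ^ (i + card {a\<in>\<gamma>. a < j}) * top_minor (\<lambda>i'. M (insert_index i i')) \<gamma>))"
proof -
  let ?s = "card {a\<in>\<gamma>. a < j}" and ?X = "top_mat (set_column M j v) (insert j \<gamma>)"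
  have card: "card (insert j \<gamma>) = Suc (card \<gamma>)" using assms by simp
  have s: "?s \<le> card \<gamma>" using assms(1) by (intro card_mono) auto
  have "{a \<in> insert j \<gamma>. a < j} = {a\<in>\<gamma>. a < j}" by auto
  then have "pick (insert j \<gamma>) ?s = j"
    using pick_card_in_set[of j "insert j \<gamma>"] by simp
  then have column: "?X $$ (i, ?s) = v i" if "i \<le> card \<gamma>" for i
    using that s card by (simp add: set_column_def)
  have "det ?X = (\<Sum>i<Suc (card \<gamma>). ?X $$ (i, ?s) * cofactor ?X i ?s)"
    using s card top_mat_carrier[of _ "insert j \<gamma>"] by (intro laplace_expansion_column) auto
  also have "\<dots> = (\<Sum>i<Suc (card \<gamma>).
      v i * ((- 1) ^ (i + ?s) * top_minor (\<lambda>i'. M (insert_index i i')) \<gamma>))"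
    using assms column
    by (intro sum.cong refl) (simp add: cofactor_def mat_delete_top_mat_insert top_minor_def)
  finally show ?thesis by (simp only: top_minor_def lessThan_Suc_atMost)
qed

lemma finite_roots_column_parameter:
  fixes M :: "nat \<Rightarrow> nat \<Rightarrow> 'a::idom"
  assumes "finite \<gamma>" and "j \<notin> \<gamma>" and "card \<gamma> \<in> T" and "top_minor M \<gamma> \<noteq> 0"
  shows "finite {y. top_minor (set_column M j (\<lambda>i. if i \<in> T then y ^ i else 0)) (insert j \<gamma>) = 0}"
proof -
  define C where "C i = (- 1) ^ (i + card {a\<in>\<gamma>. a < j}) * top_minor (\<lambda>i'. M (insert_index i i')) \<gamma>"
    for i
  have "top_minor (\<lambda>i'. M (insert_index (card \<gamma>) i')) \<gamma> = top_minor M \<gamma>"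
    by (intro top_minor_cong) simp
  then have "C (card \<gamma>) \<noteq> 0" using assms(4) by (simp add: C_def)
  define p where "p = (\<Sum>i\<le>card \<gamma>. monom (if i \<in> T then C i else 0) i)"
  have "coeff p (card \<gamma>) = C (card \<gamma>)" using assms(3) by (simp add: p_def coeff_sum_monom)
  then have "p \<noteq> 0" using \<open>C (card \<gamma>) \<noteq> 0\<close> by auto
  moreover have "poly p y = (\<Sum>i\<le>card \<gamma>. (if i \<in> T then y ^ i else 0) * C i)" for y
    unfolding p_def poly_sum poly_monom by (intro sum.cong) auto
  ultimately show ?thesis
    using poly_roots_finite[of p] by (simp add: top_minor_set_column_insert[OF assms(1,2)] C_def)
qed

lemma ex_generic_column:
  fixes M :: "nat \<Rightarrow> nat \<Rightarrow> 'a::idom"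
  assumes "infinite (UNIV :: 'a set)" and "finite J" and "j \<notin> J"
    and top: "\<And>\<gamma>. \<gamma> \<subseteq> J \<Longrightarrow> top_minor M \<gamma> \<noteq> 0"
  obtains v where "\<And>i. i \<notin> T \<Longrightarrow> v i = 0"
    and "\<And>\<gamma>. \<gamma> \<subseteq> J \<Longrightarrow> card \<gamma> \<in> T \<Longrightarrow> top_minor (set_column M j v) (insert j \<gamma>) \<noteq> 0"
proof -
  let ?v = "\<lambda>y i. if i \<in> T then y ^ i else 0"
  let ?bad = "\<lambda>\<gamma>. {y. top_minor (set_column M j (?v y)) (insert j \<gamma>) = 0}"
  have "finite (?bad \<gamma>)" if "\<gamma> \<subseteq> J" "card \<gamma> \<in> T" for \<gamma>
    using that assms(2,3) finite_subset top by (intro finite_roots_column_parameter) auto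
  then have "finite (\<Union>\<gamma>\<in>{\<gamma>. \<gamma> \<subseteq> J \<and> card \<gamma> \<in> T}. ?bad \<gamma>)"
    using assms(2) by (intro finite_UN_I) auto
  from ex_new_if_finite[OF assms(1) this]
  obtain y where "y \<notin> (\<Union>\<gamma>\<in>{\<gamma>. \<gamma> \<subseteq> J \<and> card \<gamma> \<in> T}. ?bad \<gamma>)" ..
  then show thesis by (intro that[of "?v y"]) auto
qed

lemma ex_triangular_top_minors_nonzero:
  assumes "infinite (UNIV :: 'a::idom set)"
  shows "\<exists>M :: nat \<Rightarrow> nat \<Rightarrow> 'a::idom.
    (\<forall>i j. j < i \<longrightarrow> M i j = 0) \<and> (\<forall>\<alpha>\<subseteq>{0..<m}. top_minor M \<alpha> \<noteq> 0)"
proof (induction m)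
  case 0
  show ?case by (intro exI[of _ "\<lambda>_ _. 0"]) auto
next
  case (Suc m)
  then obtain M :: "nat \<Rightarrow> nat \<Rightarrow> 'a" where tri: "\<And>i j. j < i \<Longrightarrow> M i j = 0"
    and top: "\<And>\<alpha>. \<alpha> \<subseteq> {0..<m} \<Longrightarrow> top_minor M \<alpha> \<noteq> 0" by blast
  obtain v where v: "\<And>i. i \<notin> {..m} \<Longrightarrow> v i = 0"
    and insert_nonzero: "\<And>\<gamma>. \<gamma> \<subseteq> {0..<m} \<Longrightarrow> card \<gamma> \<in> {..m} \<Longrightarrow> top_minor (set_column M m v) (insert m \<gamma>) \<noteq> 0"
    using ex_generic_column[OF assms _ _ top, of "{0..<m}" m "{..m}"] by auto
  have "top_minor (set_column M m v) \<alpha> \<noteq> 0" if \<alpha>: "\<alpha> \<subseteq> {0..<Suc m}" for \<alpha>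
  proof (cases "m \<in> \<alpha>")
    case True
    have "\<alpha> - {m} \<subseteq> {0..<m}" using \<alpha> by (auto simp: less_Suc_eq)
    moreover from this have "card (\<alpha> - {m}) \<in> {..m}" using card_mono[of "{0..<m}"] by fastforce
    ultimately show ?thesis using insert_nonzero[of "\<alpha> - {m}"] True by (simp add: insert_absorb)
  next
    case False
    then have "\<alpha> \<subseteq> {0..<m}" using \<alpha> by (auto simp: less_Suc_eq)
    then show ?thesis using top False by (simp add: top_minor_set_column_outside)
  qed
  moreover have "set_column M m v i j = 0" if "j < i" for i j
    using that tri v by (auto simp: set_column_def)
  ultimately show ?case by blast
qed

lemma ex_triangular_prescribed_zeros:
  fixes n m :: nat and Z :: "nat set"
  assumes "infinite (UNIV :: 'a::idom set)"
  obtains M :: "nat \<Rightarrow> nat \<Rightarrow> 'a::idom" where "\<And>i j. j < i \<Longrightarrow> j \<noteq> n \<Longrightarrow> M i j = 0"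
    and "\<And>i. i \<in> Z \<Longrightarrow> M i n = 0"
    and "\<And>\<alpha>. \<alpha> \<subseteq> {0..<m} \<Longrightarrow> n \<notin> \<alpha> \<or> card \<alpha> - 1 \<notin> Z \<Longrightarrow> top_minor M \<alpha> \<noteq> 0"
proof -
  obtain M :: "nat \<Rightarrow> nat \<Rightarrow> 'a" where tri: "\<And>i j. j < i \<Longrightarrow> M i j = 0"
    and top: "\<And>\<alpha>. \<alpha> \<subseteq> {0..<m} \<Longrightarrow> top_minor M \<alpha> \<noteq> 0"
    using ex_triangular_top_minors_nonzero[OF assms] by blast
  obtain v where v: "\<And>i. i \<in> Z \<Longrightarrow> v i = 0"
    and insert_nonzero: "\<And>\<gamma>. \<gamma> \<subseteq> {0..<m} - {n} \<Longrightarrow> card \<gamma> \<notin> Z \<Longrightarrow>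
      top_minor (set_column M n v) (insert n \<gamma>) \<noteq> 0"
    using ex_generic_column[OF assms _ _ top, of "{0..<m} - {n}" n "- Z"] by auto
  have "top_minor (set_column M n v) \<alpha> \<noteq> 0"
    if \<alpha>: "\<alpha> \<subseteq> {0..<m}" "n \<notin> \<alpha> \<or> card \<alpha> - 1 \<notin> Z" for \<alpha>
  proof (cases "n \<in> \<alpha>")
    case True
    then show ?thesis using insert_nonzero[of "\<alpha> - {n}"] \<alpha> by (auto simp: insert_absorb card_Diff_singleton)
  next
    case False
    then show ?thesis using top \<alpha>(1) by (simp add: top_minor_set_column_outside)
  qed
  then show thesis using tri v by (intro that[of "set_column M n v"]) (auto simp: set_column_def)
qed

section \<open>The qpr-sequence of a weighted Gram matrix\<close>

lemma quasi_principal_leading: "k \<le> m \<Longrightarrow> quasi_principal m {0..<k} {0..<k}"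
  by (simp add: quasi_principal_def)

lemma quasi_principal_leading_replace_last:
  assumes "1 \<le> k" and "k \<le> n" and "n < m"
  shows "quasi_principal m {0..<k} (insert n {0..<k - 1})"
proof -
  have "{0..<k} \<inter> insert n {0..<k - 1} = {0..<k - 1}" using assms by auto
  then show ?thesis using assms by (auto simp: quasi_principal_def)
qed

lemma qpr_entry_eq_A:
  assumes "\<And>\<alpha> \<beta>. quasi_principal (dim_row B) \<alpha> \<beta> \<Longrightarrow> card \<alpha> = k \<Longrightarrow> det (submatrix B \<alpha> \<beta>) \<noteq> 0"
  shows "qpr_entry B k = A"
  using assms by (auto simp: qpr_entry_def qp_minors_def)

lemma qpr_entry_eq_S:
  assumes "quasi_principal (dim_row B) \<alpha> \<beta>" "card \<alpha> = k" "det (submatrix B \<alpha> \<beta>) = 0"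
    and "quasi_principal (dim_row B) \<gamma> \<delta>" "card \<gamma> = k" "det (submatrix B \<gamma> \<delta>) \<noteq> 0"
  shows "qpr_entry B k = S"
proof -
  have "det (submatrix B \<alpha> \<beta>) \<in> qp_minors B k" "det (submatrix B \<gamma> \<delta>) \<in> qp_minors B k"
    using assms unfolding qp_minors_def by blast+
  then show ?thesis using assms(3,6) by (auto simp: qpr_entry_def)
qed

lemma qpr_entry_eq_N:
  assumes "k \<le> dim_row B"
    and "\<And>\<alpha> \<beta>. quasi_principal (dim_row B) \<alpha> \<beta> \<Longrightarrow> card \<alpha> = k \<Longrightarrow> det (submatrix B \<alpha> \<beta>) = 0"
  shows "qpr_entry B k = N"
proof -
  have "det (submatrix B {0..<k} {0..<k}) \<in> qp_minors B k"
    using quasi_principal_leading[OF assms(1)] unfolding qp_minors_def by force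
  then show ?thesis using assms(2) by (auto simp: qpr_entry_def qp_minors_def)
qed

lemma qpr_entry_gram_mat_N:
  assumes "n < k" and "k \<le> m"
  shows "qpr_entry (gram_mat d M n m) k = N"
  using assms by (intro qpr_entry_eq_N)
    (auto simp: quasi_principal_def intro!: det_submatrix_gram_mat_eq_0[of _ _ _ k])

lemma qpr_entry_gram_mat_A:
  assumes "generic_weights M n m d" and "k \<le> n"
    and "\<And>\<alpha>. \<alpha> \<subseteq> {0..<m} \<Longrightarrow> card \<alpha> = k \<Longrightarrow> top_minor M \<alpha> \<noteq> 0"
  shows "qpr_entry (gram_mat d M n m) k = A"
  using assms by (intro qpr_entry_eq_A) (auto simp: quasi_principal_def generic_weights_def)

lemma qpr_entry_gram_mat_S:
  assumes "generic_weights M n m d" and k: "1 \<le> k" "k \<le> n" and "n < m"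
    and tri: "\<And>i j. j < i \<Longrightarrow> j \<noteq> n \<Longrightarrow> M i j = 0" and "M (k - 1) n = 0"
    and top: "top_minor M {0..<k} \<noteq> 0"
  shows "qpr_entry (gram_mat d M n m) k = S"
proof (rule qpr_entry_eq_S)
  let ?\<beta> = "insert n {0..<k - 1}"
  have "card ?\<beta> = k" using k by auto
  then have "top_minor M ?\<beta> = 0"
    using k tri \<open>M (k - 1) n = 0\<close> by (intro top_minor_eq_0_if_row_0[of "k - 1"]) auto
  then show "det (submatrix (gram_mat d M n m) {0..<k} ?\<beta>) = 0"
    using k \<open>n < m\<close> tri \<open>card ?\<beta> = k\<close> by (subst det_submatrix_gram_mat[where k = k]) auto
  show "det (submatrix (gram_mat d M n m) {0..<k} {0..<k}) \<noteq> 0"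
    using assms by (simp add: generic_weights_def)
  show "quasi_principal (dim_row (gram_mat d M n m)) {0..<k} ?\<beta>"
    using quasi_principal_leading_replace_last[OF k \<open>n < m\<close>] by simp
qed (use k \<open>n < m\<close> in \<open>auto intro: quasi_principal_leading\<close>)

lemma qpr_eqI:
  assumes "dim_row B = length q" and "\<And>i. i < length q \<Longrightarrow> qpr_entry B (Suc i) = q ! i"
  shows "qpr B = q"
  using assms by (intro nth_equalityI) (simp_all add: qpr_def del: upt_Suc)

theorem theorem3p6:
  fixes n t :: nat and q :: "qpr_letter list"
  assumes "n \<ge> 1" and "t \<ge> 1"
    and "length q = n" and "set q \<subseteq> {A, S}"
  shows "\<exists>B :: 'a::field_char_0 mat.
           B \<in> carrier_mat (n + t) (n + t) \<and> transpose_mat B = B \<and>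
           qpr B = q @ replicate t N"
proof -
  define Z where "Z = {i. i < n \<and> q ! i = S}"
  obtain M :: "nat \<Rightarrow> nat \<Rightarrow> 'a" where tri: "\<And>i j. j < i \<Longrightarrow> j \<noteq> n \<Longrightarrow> M i j = 0"
    and zero: "\<And>i. i \<in> Z \<Longrightarrow> M i n = 0"
    and top: "\<And>\<alpha>. \<alpha> \<subseteq> {0..<n + t} \<Longrightarrow> n \<notin> \<alpha> \<or> card \<alpha> - 1 \<notin> Z \<Longrightarrow> top_minor M \<alpha> \<noteq> 0"
    using ex_triangular_prescribed_zeros[OF infinite_UNIV_char_0] by blast
  obtain d where d: "generic_weights M n (n + t) d"
    using ex_generic_weights[OF infinite_UNIV_char_0] by blast
  have "qpr (gram_mat d M n (n + t)) = q @ replicate t N"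
  proof (rule qpr_eqI)
    fix i assume "i < length (q @ replicate t N)"
    then consider "i < n" "q ! i = A" | "i < n" "q ! i = S" | "n \<le> i" "i < n + t"
      using assms(3,4) nth_mem[of i q] by fastforce
    then show "qpr_entry (gram_mat d M n (n + t)) (Suc i) = (q @ replicate t N) ! i"
      using assms(2,3) d tri zero top
      by cases (auto simp: nth_append Z_def qpr_entry_gram_mat_A qpr_entry_gram_mat_S
          qpr_entry_gram_mat_N)
  qed (simp add: assms(3))
  then show ?thesis using gram_mat_carrier transpose_gram_mat by blast
qed

end
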